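(* Let $n\ge 0$ and let $\mathbf{w}$ be a ladder word of length $n$, i.e. $\mathbf{w}=\varepsilon LLLL\cdots$ or $\mathbf{w}=\varepsilon RRRR\cdots$ (all letters after $\varepsilon$ equal). Then the $h^*$-polynomial of the order polytope $\mathcal{O}(P(\mathbf{w}))$ is $$h^*(\mathbf{w};z)=\sum_{i=0}^{n+1}N(n+2,i+1)\,z^i,$$ where $N(x,y)$ denotes the Narayana number.
   Context: Generalized snake words: for $n\ge 0$, a generalized snake word of length $n$ is $\mathbf{w}=w_0w_1\cdots w_n$ where $w_0=\varepsilon$ is the empty letter and $w_i\in\{L,R\}$ for $1\le i\le n$. Generalized snake posets: $P(\mathbf{w})$ is defined recursively. $P(\varepsilon)$ is the poset on $\{0,1,2,3\}$ with cover relations $1\prec 0$, $2\prec 0$, $3\prec 1$, $3\prec 2$. For $n\ge 1$, $P(w_0w_1\cdots w_n)$ is $P(w_0\cdots w_{n-1})\cup\{2n+2,2n+3\}$ with the added cover relations $2n+3\prec 2n+1$, $2n+3\prec 2n+2$, and: $2n+2\prec 2n-1$ if ($n=1$ and $w_1=L$) or ($n\ge2$ and $w_{n-1}w_n\in\{RL,LR\}$); $2n+2\prec 2n$ if ($n=1$ and $w_1=R$) or ($n\ge 2$ and $w_{n-1}w_n\in\{LL,RR\}$). Order polytope: for a finite poset $P$, $\mathcal{O}(P)=\{x\in[0,1]^P: x_i\le x_j \text{ whenever } i<_P j\}\subset\mathbb{R}^P$, a lattice polytope of dimension $|P|$. $h^*$-polynomial: $h^*(\mathbf{w};z)$ is the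 polynomial defined by $\sum_{t\ge0}|t\,\mathcal{O}(P(\mathbf{w}))\cap\mathbb{Z}^{P(\mathbf{w})}|\,z^t=\dfrac{h^*(\mathbf{w};z)}{(1-z)^{d+1}}$ with $d=|P(\mathbf{w})|=2n+4$. Narayana numbers: $N(n,k)=\frac1n\binom nk\binom n{k-1}$. *)

theory Defs
  imports Complex_Main "HOL-Library.FuncSet" "HOL-Computational_Algebra.Computational_Algebra"
begin

datatype letter = L | R

text \<open>
  A generalized snake word \<open>w\<^sub>0 w\<^sub>1 \<dots> w\<^sub>n\<close> is a list of length \<open>n\<close>: the empty letter
  \<open>w\<^sub>0\<close> is left implicit.
\<close>

type_synonym snake_word = "letter list"

definition letter_at :: "snake_word \<Rightarrow> nat \<Rightarrow> letter" where
  "letter_at w i = w ! (i - 1)"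

text \<open>
  \<open>snake_covers w n\<close> are the cover relations of \<open>P(w\<^sub>0 \<dots> w\<^sub>n)\<close>, for \<open>n \<le> length w\<close>.
  A pair \<open>(a, b)\<close> means that \<open>a\<close> is covered by \<open>b\<close>.
\<close>

primrec snake_covers :: "snake_word \<Rightarrow> nat \<Rightarrow> (nat \<times> nat) set" where
  "snake_covers w 0 = {(1, 0), (2, 0), (3, 1), (3, 2)}"
| "snake_covers w (Suc k) =
    (let n = Suc k;
         turn = (if n = 1 then letter_at w 1 = L else letter_at w (n - 1) \<noteq> letter_at w n)
     in snake_covers w k \<union>
        {(2 * n + 3, 2 * n + 1), (2 * n + 3, 2 * n + 2),
         (2 * n + 2, if turn then 2 * n - 1 else 2 * n)})"

text \<open>The four elements of \<open>P(\<epsilon>)\<close>, and two new ones \<open>2n+2\<close>, \<open>2n+3\<close> for each letter.\<close>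

definition snake_carrier :: "snake_word \<Rightarrow> nat set" where
  "snake_carrier w = {..<2 * length w + 4}"

definition snake_less :: "snake_word \<Rightarrow> (nat \<times> nat) set" where
  "snake_less w = (snake_covers w (length w))\<^sup>+"

text \<open>
  In the following, a finite poset is given by its carrier \<open>P\<close> and its strict order \<open>r\<close>, and
  \<open>\<real>\<^sup>P\<close> is the set \<open>P \<rightarrow>\<^sub>E UNIV\<close> of real functions that are \<open>undefined\<close> outside \<open>P\<close>, so that
  points of \<open>\<real>\<^sup>P\<close> are not counted twice.
\<close>

definition order_polytope :: "'a set \<Rightarrow> ('a \<times> 'a) set \<Rightarrow> ('a \<Rightarrow> real) set" where
  "order_polytope P r =
    {x \<in> P \<rightarrow>\<^sub>E {0..1}. \<forall>i\<in>P. \<forall>j\<in>P. (i, j) \<in> r \<longrightarrow> x i \<le> x j}"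

definition dilate :: "'a set \<Rightarrow> nat \<Rightarrow> ('a \<Rightarrow> real) set \<Rightarrow> ('a \<Rightarrow> real) set" where
  "dilate P t K = (\<lambda>x. \<lambda>i\<in>P. real t * x i) ` K"

definition ehrhart_series :: "'a set \<Rightarrow> ('a \<Rightarrow> real) set \<Rightarrow> real fps" where
  "ehrhart_series P K = Abs_fps (\<lambda>t. real (card (dilate P t K \<inter> (P \<rightarrow>\<^sub>E \<int>))))"

text \<open>The exponent is \<open>d + 1\<close> because the order polytope of \<open>P\<close> has dimension \<open>d = card P\<close>.\<close>

definition order_polytope_hstar :: "'a set \<Rightarrow> ('a \<times> 'a) set \<Rightarrow> real poly" where
  "order_polytope_hstar P r =
    (THE h. ehrhart_series P (order_polytope P r) =
            fps_of_poly h / (1 - fps_X) ^ (card P + 1))"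

definition snake_hstar :: "snake_word \<Rightarrow> real poly" where
  "snake_hstar w = order_polytope_hstar (snake_carrier w) (snake_less w)"

text \<open>The case \<open>k = 0\<close> is separate because \<open>k - 1\<close> truncates on \<open>nat\<close>.\<close>

definition narayana :: "nat \<Rightarrow> nat \<Rightarrow> real" where
  "narayana n k =
    (if k = 0 then 0 else 1 / real n * real (n choose k) * real (n choose (k - 1)))"

end

theory Submission
  imports Defs "HOL-Combinatorics.Transposition"
begin

text \<open>
  Put \<open>m = n + 2\<close>. The ladder poset is the product of a chain with \<open>2\<close> and a chain with \<open>m\<close>
  elements, and the lattice points of the \<open>t\<close>-th dilate of its order polytope are in bijection with
  the order-reversing maps from the poset to \<open>{0, \<dots>, t}\<close>, that is, with the \<open>m\<close> by \<open>2\<close> arrays with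
  entries in \<open>{0, \<dots>, t}\<close> that weakly increase along rows and columns. The Ehrhart polynomial is thus
  a box number of MacMahon, given by a two by two determinant of binomial coefficients; here this
  is obtained by induction on \<open>m\<close> (\<open>card_ladder_fillings\<close>), with a separate bound for each of the
  two chains, because the determinant is then governed by a difference equation with a boundary
  condition.

  As a function of \<open>t\<close>, the determinant is the coefficient sequence of the hypergeometric series
  \<open>\<^sub>2F\<^sub>1(m + 1, m + 2; 2; z)\<close>. Euler's transformation
  \<open>(1 - z)\<^sup>s \<^sub>2F\<^sub>1(a, b; c; z) = \<^sub>2F\<^sub>1(c - a, c - b; c; z)\<close>, where \<open>s = a + b - c\<close>
  (\<open>euler_transformation\<close>) has the exponent \<open>2m + 1\<close> in this case, which is one more than the
  number of elements of the poset, so that its right-hand side \<open>\<^sub>2F\<^sub>1(1 - m, -m; 2; z)\<close> is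
  the \<open>h\<^sup>*\<close>-polynomial. This is a polynomial of degree \<open>m - 1\<close>, and its coefficients are the
  Narayana numbers \<open>N(m, i + 1)\<close>.
\<close>

section \<open>Euler's transformation of hypergeometric series\<close>

text \<open>
  Comparing coefficients turns the hypergeometric differential equation into a recurrence of
  order one, which determines a power series from its constant coefficient as long as \<open>c\<close> is not a
  nonpositive integer.
\<close>

lemma hypergeometric_ode_iff_recurrence:
  fixes F :: "'a::field_char_0 fps"
  shows "fps_X * (1 - fps_X) * fps_deriv (fps_deriv F)
           + (fps_const c - fps_const (a + b + 1) * fps_X) * fps_deriv F
           - fps_const (a * b) * F = 0
         \<longleftrightarrow> (\<forall>k. of_nat (Suc k) * (c + of_nat k) * F $ Suc k = (a + of_nat k) * (b + of_nat k) * F $ k)"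
    (is "?ode = 0 \<longleftrightarrow> _")
proof -
  have "?ode $ k = of_nat (Suc k) * (c + of_nat k) * F $ Suc k - (a + of_nat k) * (b + of_nat k) * F $ k" for k
  proof -
    have "?ode = fps_X * fps_deriv (fps_deriv F) - fps_X * (fps_X * fps_deriv (fps_deriv F))
       + fps_const c * fps_deriv F - fps_const (a + b + 1) * (fps_X * fps_deriv F)
           - fps_const (a * b) * F"
      by (simp add: algebra_simps)
    then show ?thesis
      by (cases k; cases "k - 1") (simp_all add: algebra_simps)
  qed
  then show ?thesis
    by (simp add: fps_eq_iff)
qed

lemma hypergeometric_recurrence:
  fixes a b c :: "'a::field_char_0"
  assumes "\<And>k. c + of_nat k \<noteq> 0"
  shows "of_nat (Suc k) * (c + of_nat k) * fps_hypergeo [a, b] [c] 1 $ Suc k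
         = (a + of_nat k) * (b + of_nat k) * fps_hypergeo [a, b] [c] 1 $ k"
proof -
  have "of_nat (Suc k) \<noteq> (0 :: 'a)"
    by (rule of_nat_neq_0)
  then show ?thesis
    using assms[of k] unfolding fps_hypergeo_rec
    by (simp add: mult_ac del: of_nat_Suc fps_hypergeo_nth)
qed

text \<open>
  The left-hand side solves the hypergeometric equation with the parameters \<open>c - a\<close>, \<open>c - b\<close>, \<open>c\<close>
  and has the constant coefficient \<open>1\<close>, which identifies it. The derivatives of \<open>H = (1 - z)\<^sup>s F\<close>
  are expressed through those of \<open>F\<close> after multiplication by powers of \<open>1 - z\<close>, so that all
  terms share the factor \<open>(1 - z)\<^sup>s\<close>; the surplus power is cancelled at the end.
\<close>

theorem euler_transformation:
  fixes a b c :: "'a::field_char_0"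
  assumes c: "\<And>k. c + of_nat k \<noteq> 0" and s: "of_nat s = a + b - c"
  shows "(1 - fps_X) ^ s * fps_hypergeo [a, b] [c] 1 = fps_hypergeo [c - a, c - b] [c] 1"
proof -
  define u :: "'a fps" where "u = 1 - fps_X"
  define F where "F = fps_hypergeo [a, b] [c] 1"
  define H where "H = u ^ s * F"
  define S :: "'a fps" where "S = of_nat s"
  define A where "A = fps_const a"
  define B where "B = fps_const b"
  define C where "C = fps_const c"
  define F1 where "F1 = fps_deriv F"
  define F2 where "F2 = fps_deriv F1"
  define H1 where "H1 = fps_deriv H"
  define H2 where "H2 = fps_deriv H1"
  define U where "U = u ^ s"
  have du: "fps_deriv u = -1"
    by (simp add: u_def)
  have dU: "u * fps_deriv U = - S * U"
  proof (cases s)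
    case (Suc k)
    have "fps_deriv U = - S * u ^ k"
      unfolding U_def S_def fps_deriv_power' by (simp add: Suc du)
    then show ?thesis
      by (simp add: U_def Suc mult_ac)
  qed (simp add: U_def S_def)
  have X: "fps_X = 1 - u"
    by (simp add: u_def)
  have S: "S = A + B - C"
    unfolding S_def A_def B_def C_def fps_of_nat[symmetric] s
    by simp
  have odeF: "(1 - u) * u * F2 + (C - (A + B + 1) * (1 - u)) * F1 - A * B * F = 0"
    using hypergeometric_ode_iff_recurrence[of F c a b] hypergeometric_recurrence[OF c, of _ a b]
    unfolding F_def[symmetric] F1_def[symmetric] F2_def[symmetric] X
    by (simp add: A_def B_def C_def flip: fps_const_add fps_const_mult)
  have uH1: "u * H1 = U * (u * F1 - S * F)"
  proof -
    have "u * H1 = (u * fps_deriv U) * F + u * U * F1"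
      by (simp add: H1_def H_def U_def F1_def algebra_simps)
    then show ?thesis
      unfolding dU by (simp add: algebra_simps)
  qed
  have uH2: "u * (u * H2) = U * (u * u * F2 - 2 * S * u * F1 + S * (S - 1) * F)"
  proof -
    have "fps_deriv (u * H1) = fps_deriv (U * (u * F1 - S * F))"
      by (simp only: uH1)
    then have "u * H2 - H1 = fps_deriv U * (u * F1 - S * F) + U * (u * F2 - F1 - S * F1)"
      by (simp add: du H2_def F2_def F1_def S_def algebra_simps)
    then have "u * (u * H2 - H1) = u * (fps_deriv U * (u * F1 - S * F) + U * (u * F2 - F1 - S * F1))"
      by (simp only:)
    then have "u * (u * H2 - H1)
        = (u * fps_deriv U) * (u * F1 - S * F) + u * U * (u * F2 - F1 - S * F1)"
      by (simp add: algebra_simps)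
    then have "u * (u * H2) = u * H1 + (- S * U) * (u * F1 - S * F) + u * U * (u * F2 - F1 - S * F1)"
      unfolding dU by (simp add: algebra_simps)
    then show ?thesis
      unfolding uH1 by (simp add: algebra_simps)
  qed
  \<comment> \<open>The operator for \<open>H\<close>, times \<open>u\<close>, is \<open>u\<^sup>s u\<close> times the operator for \<open>F\<close>.\<close>
  have "u * ((1 - u) * u * H2 + (C - ((C - A) + (C - B) + 1) * (1 - u)) * H1 - (C - A) * (C - B) * H)
      = (1 - u) * (u * (u * H2)) + (C - ((C - A) + (C - B) + 1) * (1 - u)) * (u * H1)
         - (C - A) * (C - B) * u * U * F"
    by (simp add: H_def U_def algebra_simps)
  also have "\<dots> = U * u * ((1 - u) * u * F2 + (C - (A + B + 1) * (1 - u)) * F1 - A * B * F)"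
    unfolding uH1 uH2 S by algebra
  also have "\<dots> = 0"
    unfolding odeF by simp
  finally have "u * ((1 - u) * u * H2 + (C - ((C - A) + (C - B) + 1) * (1 - u)) * H1 - (C - A) * (C - B) * H) = 0" .
  moreover have "u $ 0 = 1"
    by (simp add: u_def)
  then have "u \<noteq> 0"
    by auto
  ultimately have odeH:
    "(1 - u) * u * H2 + (C - ((C - A) + (C - B) + 1) * (1 - u)) * H1 - (C - A) * (C - B) * H = 0"
    by simp
  have "1 - (1 - u) = u"
    by simp
  with odeH have "fps_X * (1 - fps_X) * fps_deriv (fps_deriv H)
      + (fps_const c - fps_const (c - a + (c - b) + 1) * fps_X) * fps_deriv H
      - fps_const ((c - a) * (c - b)) * H = 0"
    by (simp only: X A_def B_def C_def H1_def H2_def fps_const_1_eq_1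
        flip: fps_const_add fps_const_mult fps_const_sub)
  then have recH: "of_nat (Suc k) * (c + of_nat k) * H $ Suc k
       = (c - a + of_nat k) * (c - b + of_nat k) * H $ k" for k
    unfolding hypergeometric_ode_iff_recurrence by blast
  have "H $ k = fps_hypergeo [c - a, c - b] [c] 1 $ k" for k
  proof (induction k)
    case 0
    then show ?case
      by (simp add: H_def u_def F_def fps_nth_power_0 del: fps_hypergeo_nth)
  next
    case (Suc k)
    have "of_nat (Suc k) * (c + of_nat k) * H $ Suc k
        = of_nat (Suc k) * (c + of_nat k) * fps_hypergeo [c - a, c - b] [c] 1 $ Suc k"
      unfolding recH hypergeometric_recurrence[OF c] Suc ..
    then show ?case
      using c[of k] by (simp del: of_nat_Suc fps_hypergeo_nth)
  qed
  then show ?thesis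
    by (simp add: fps_eq_iff H_def u_def F_def del: fps_hypergeo_nth)
qed

section \<open>A determinant and the Narayana numbers\<close>

text \<open>
  The Lindstroem-Gessel-Viennot determinant for pairs of weakly increasing sequences of length \<open>m\<close>
  with the first pointwise below the second, where the first is bounded by \<open>y\<close> and the second
  by \<open>x\<close>. It counts such pairs only for \<open>y \<le> x\<close>; its value at \<open>y = x + 1\<close> serves as a
  boundary condition.
\<close>

definition path_determinant :: "nat \<Rightarrow> nat \<Rightarrow> nat \<Rightarrow> int" where
  "path_determinant m y x =
     int ((m + x) choose x) * int ((m + y) choose y)
     - int ((m + x) choose Suc x) * int ((m + y) choose Suc m)"

text \<open>
  On the diagonal both products are rational multiples of the square of \<open>(m + t) choose t\<close>, which
  turns the determinant into a single hypergeometric term.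
\<close>

lemma path_determinant_hypergeometric:
  "real_of_int (path_determinant m t t) = fps_hypergeo [real m + 1, real m + 2] [2] 1 $ t"
proof -
  define c where "c = real ((m + t) choose t)"
  have sym: "(m + t) choose m = (m + t) choose t"
    using binomial_symmetric[of m "m + t"] by simp
  have p: "real ((m + t) choose Suc t) = c * real m / real (Suc t)"
  proof -
    have "Suc t * ((m + t) choose Suc t) = m * ((m + t) choose t)"
      using binomial_absorb_comp[of "m + t" t] binomial_absorption[of t "m + t"] by simp
    then have "real (Suc t) * real ((m + t) choose Suc t) = real m * c"
      unfolding c_def of_nat_mult[symmetric] by presburger
    then show ?thesis by (simp add: field_simps del: of_nat_Suc)
  qed
  have q: "real ((m + t) choose Suc m) = c * real t / real (Suc m)"
  proof -
    have "Suc m * ((m + t) choose Suc m) = t * ((m + t) choose m)"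
      using binomial_absorb_comp[of "m + t" m] binomial_absorption[of m "m + t"] by simp
    then have "real (Suc m) * real ((m + t) choose Suc m) = real t * c"
      unfolding c_def of_nat_mult[symmetric] sym by presburger
    then show ?thesis by (simp add: field_simps del: of_nat_Suc)
  qed
  have "real_of_int (path_determinant m t t) = c\<^sup>2 * (real m + real t + 1) / (real (Suc m) * real (Suc t))"
  proof -
    have "c * c - (c * k / T) * (c * l / M) = c\<^sup>2 * (k + l + 1) / (M * T)"
      if "M = k + 1" "T = l + 1" "M \<noteq> 0" "T \<noteq> 0" for M T k l :: real
    proof -
      have "(c * c - (c * k / T) * (c * l / M)) * (M * T) = c * c * (M * T - k * l)"
        using that(3,4) by (simp add: field_simps)
      also have "\<dots> = c\<^sup>2 * (k + l + 1)"
        unfolding that(1,2) by algebra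
      finally show ?thesis
        using that(3,4) by (simp add: eq_divide_eq)
    qed
    from this[of "1 + real m" "real m" "1 + real t" "real t"] show ?thesis
      using sym by (simp add: path_determinant_def p q c_def[symmetric] mult.commute)
  qed
  also have "\<dots> = pochhammer (real m + 1) t * pochhammer (real m + 2) t / (pochhammer 2 t * fact t)"
  proof -
    have c: "c = pochhammer (real m + 1) t / fact t"
      by (simp add: c_def binomial_gbinomial gbinomial_pochhammer' add_ac)
    have shift: "pochhammer (a + 1) t * a = pochhammer a t * (a + real t)" for a :: real
      using pochhammer_rec[of a t] pochhammer_rec'[of a t] by (simp add: mult_ac)
    have "pochhammer (real m + 2) t * (real m + 1) = pochhammer (real m + 1) t * (real m + real t + 1)"
      using shift[of "real m + 1"] by (simp add: add_ac)
    then have p2: "pochhammer (real m + 2) t = pochhammer (real m + 1) t * (real m + real t + 1) / (real m + 1)"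
      by (simp add: field_simps)
    have two: "pochhammer (2::real) t = fact t * (real t + 1)"
      using shift[of 1] by (simp add: pochhammer_fact add_ac)
    show ?thesis
      unfolding c p2 two by (simp add: field_simps power2_eq_square)
  qed
  finally show ?thesis
    by simp
qed

lemma narayana_hypergeometric:
  assumes "m \<ge> 1"
  shows "narayana m (i + 1) = fps_hypergeo [1 - real m, - real m] [2] 1 $ i"
proof -
  obtain k where k: "m = Suc k"
    using assms by (cases m) auto
  have sgn: "(- 1) ^ i * (- 1) ^ i = (1::real)"
    by (simp flip: power_mult_distrib)
  have "real (m choose Suc i) = real m * real (k choose i) / real (Suc i)"
  proof -
    have "real (Suc i) * real (m choose Suc i) = real m * real (k choose i)"
      unfolding k of_nat_mult[symmetric] by (metis Suc_times_binomial_eq mult.commute)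
    then show ?thesis by (simp add: field_simps del: of_nat_Suc)
  qed
  then have "narayana m (i + 1) = real (k choose i) * real (m choose i) / real (Suc i)"
    using assms by (simp add: narayana_def)
  also have "\<dots> = (pochhammer (1 - real m) i / fact i) * (pochhammer (- real m) i / fact i) / real (Suc i)"
    using sgn by (simp add: binomial_gbinomial gbinomial_pochhammer k mult_ac)
  also have "\<dots> = fps_hypergeo [1 - real m, - real m] [2] 1 $ i"
  proof -
    have "pochhammer (2::real) i = fact (Suc i)"
      using pochhammer_rec[of "1::real" i] by (simp add: pochhammer_fact)
    then show ?thesis by (simp add: field_simps)
  qed
  finally show ?thesis .
qed

text \<open>
  Euler's transformation with \<open>a = m + 1\<close>, \<open>b = m + 2\<close>, \<open>c = 2\<close>, hence with the exponent
  \<open>a + b - c = 2m + 1\<close>.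
\<close>

lemma path_determinant_series:
  assumes "m \<ge> 1"
  shows "(1 - fps_X) ^ (2 * m + 1) * Abs_fps (\<lambda>t. real_of_int (path_determinant m t t))
       = fps_of_poly (\<Sum>i<m. monom (narayana m (i + 1)) i)"
proof -
  have "Abs_fps (\<lambda>t. real_of_int (path_determinant m t t)) = fps_hypergeo [real m + 1, real m + 2] [2] 1"
    by (simp add: fps_eq_iff path_determinant_hypergeometric del: fps_hypergeo_nth)
  moreover have "(1 - fps_X) ^ (2 * m + 1) * fps_hypergeo [real m + 1, real m + 2] [2] 1
      = fps_hypergeo [2 - (real m + 1), 2 - (real m + 2)] [2] 1"
  proof (rule euler_transformation)
    show "2 + real k \<noteq> 0" for k
      by linarith
  qed simp
  moreover have "fps_hypergeo [2 - (real m + 1), 2 - (real m + 2)] [2] 1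
       = fps_of_poly (\<Sum>i<m. monom (narayana m (i + 1)) i)"
  proof -
    have "coeff (\<Sum>i<m. monom (narayana m (i + 1)) i) k = narayana m (k + 1)" for k
      by (simp add: coeff_sum narayana_def)
    then show ?thesis
      using narayana_hypergeometric[OF assms]
      by (simp add: fps_eq_iff del: fps_hypergeo_nth)
  qed
  ultimately show ?thesis
    by simp
qed

section \<open>Counting fillings of the ladder\<close>

text \<open>
  The two chains of the ladder are the even and the odd numbers, so that \<open>2i\<close> and \<open>2i + 1\<close> form the
  \<open>i\<close>-th rung. The bounds are imposed on all entries rather than on the last rung only: this covers
  \<open>m = 0\<close>, and in the recursion the entries of the last rung become the bounds of the others.
\<close>

definition ladder_fillings :: "nat \<Rightarrow> nat \<Rightarrow> nat \<Rightarrow> (nat \<Rightarrow> nat) set" where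
  "ladder_fillings m y x =
     {g \<in> {..<2 * m} \<rightarrow>\<^sub>E UNIV.
        (\<forall>i<m. g (2 * i) \<le> g (2 * i + 1) \<and> g (2 * i) \<le> y \<and> g (2 * i + 1) \<le> x) \<and>
        (\<forall>i. Suc i < m \<longrightarrow> g (2 * i) \<le> g (2 * i + 2) \<and> g (2 * i + 1) \<le> g (2 * i + 3))}"

lemma ladder_fillings_0: "ladder_fillings 0 y x = {\<lambda>_. undefined}"
  by (simp add: ladder_fillings_def)

text \<open>
  The last rung \<open>(a, b)\<close> dominates all others, so removing it leaves an arbitrary filling with
  the bounds \<open>a\<close> and \<open>b\<close>.
\<close>

lemma ladder_fillings_Suc:
  "bij_betw (\<lambda>((a, b), g). g(2 * m := a, 2 * m + 1 := b))
     (SIGMA (a, b) : (SIGMA a : {..y}. {a..x}). ladder_fillings m a b)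
     (ladder_fillings (Suc m) y x)"
  (is "bij_betw ?f ?A ?B")
proof (rule bij_betw_byWitness[where f' = "\<lambda>g. ((g (2 * m), g (2 * m + 1)), restrict g {..<2 * m})"])
  let ?f' = "\<lambda>g::nat\<Rightarrow>nat. ((g (2 * m), g (2 * m + 1)), restrict g {..<2 * m})"
  have "restrict (g(2 * m := a, 2 * m + 1 := b)) {..<2 * m} = g"
    if "g \<in> ladder_fillings m a b" for a b g
    using that by (auto simp: ladder_fillings_def fun_eq_iff PiE_def extensional_def restrict_def)
  then show "\<forall>p\<in>?A. ?f' (?f p) = p"
    by auto
  show "\<forall>g\<in>?B. ?f (?f' g) = g"
    by (auto simp: ladder_fillings_def fun_eq_iff PiE_def extensional_def restrict_def)
  have "g(2 * m := a, 2 * m + 1 := b) \<in> ladder_fillings (Suc m) y x"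
    if "a \<le> y" "a \<le> b" "b \<le> x" and g: "g \<in> ladder_fillings m a b" for a b g
  proof -
    let ?h = "g(2 * m := a, 2 * m + 1 := b)"
    have even_odd: "2 * i + 1 \<noteq> 2 * j" "2 * i \<noteq> 2 * j + 1" for i j :: nat
      by presburger+
    have h: "?h (2 * i) = (if i = m then a else g (2 * i))"
      "?h (2 * i + 1) = (if i = m then b else g (2 * i + 1))"
      "?h (2 * i + 2) = (if Suc i = m then a else g (2 * i + 2))"
      "?h (2 * i + 3) = (if Suc i = m then b else g (2 * i + 3))" for i
      using even_odd[of i m] even_odd[of "Suc i" m] by (auto simp: numeral_3_eq_3)
    have "?h \<in> {..<2 * Suc m} \<rightarrow>\<^sub>E UNIV"
      using g by (auto simp: ladder_fillings_def PiE_def extensional_def)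
    moreover have "\<forall>i<Suc m. ?h (2 * i) \<le> ?h (2 * i + 1) \<and> ?h (2 * i) \<le> y \<and> ?h (2 * i + 1) \<le> x"
      unfolding h using that by (fastforce simp: ladder_fillings_def less_Suc_eq)
    moreover have "\<forall>i. Suc i < Suc m \<longrightarrow> ?h (2 * i) \<le> ?h (2 * i + 2) \<and> ?h (2 * i + 1) \<le> ?h (2 * i + 3)"
      unfolding h using that by (auto simp: ladder_fillings_def)
    ultimately show ?thesis
      unfolding ladder_fillings_def by blast
  qed
  then show "?f ` ?A \<subseteq> ?B"
    by auto
  have "?f' g \<in> ?A" if g: "g \<in> ?B" for g
  proof -
    have even: "g (2 * i) \<le> g (2 * m)" and odd: "g (2 * i + 1) \<le> g (2 * m + 1)" if "i \<le> m" for i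
      using that
    proof (induction rule: inc_induct)
      case (step i)
      have "g (2 * i) \<le> g (2 * Suc i)" "g (2 * i + 1) \<le> g (2 * Suc i + 1)"
        using g step.hyps by (auto simp: ladder_fillings_def numeral_3_eq_3)
      with step.IH show "g (2 * i) \<le> g (2 * m)" "g (2 * i + 1) \<le> g (2 * m + 1)"
        by linarith+
    qed auto
    have "restrict g {..<2 * m} \<in> ladder_fillings m (g (2 * m)) (g (2 * m + 1))"
      using g even odd by (auto simp: ladder_fillings_def)
    moreover have "g (2 * m) \<le> y" "g (2 * m) \<le> g (2 * m + 1)" "g (2 * m + 1) \<le> x"
      using g by (auto simp: ladder_fillings_def)
    ultimately show ?thesis
      by auto
  qed
  then show "?f' ` ?B \<subseteq> ?A"
    by blast
qed

text \<open>
  Pascal's rule in each of the two rows: the mixed second difference of a product \<open>f(x) g(y)\<close> is the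
  product of the differences, and every entry of the determinant for \<open>m + 1\<close> has the
  corresponding entry for \<open>m\<close> as its difference.
\<close>

lemma path_determinant_difference:
  "path_determinant (Suc m) (Suc y) (Suc x) - path_determinant (Suc m) (Suc y) x
   - path_determinant (Suc m) y (Suc x) + path_determinant (Suc m) y x
   = path_determinant m (Suc y) (Suc x)"
proof -
  define c where "c k = int ((Suc m + k) choose k)" for k
  define p where "p k = int ((Suc m + k) choose Suc k)" for k
  define q where "q k = int ((Suc m + k) choose Suc (Suc m))" for k
  have pascal: "int ((m + Suc k) choose Suc k) = c (Suc k) - c k"
    "int ((m + Suc k) choose Suc (Suc k)) = p (Suc k) - p k"
    "int ((m + Suc k) choose Suc m) = q (Suc k) - q k" for k
    by (simp_all add: c_def p_def q_def)
  show ?thesis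
    unfolding path_determinant_def pascal c_def[symmetric] p_def[symmetric] q_def[symmetric]
    by algebra
qed

text \<open>
  For a pair of sequences whose second member is bounded by \<open>y\<close>, relaxing the bound of the first
  member to \<open>y + 1\<close> admits nothing new. The determinant agrees, by the symmetry of binomial
  coefficients.
\<close>

lemma path_determinant_boundary:
  "path_determinant (Suc m) (Suc y) y = path_determinant (Suc m) y y"
proof -
  have "(Suc m + y) choose m = (Suc m + y) choose Suc y" "(Suc m + y) choose Suc m = (Suc m + y) choose y"
    using binomial_symmetric[of m "Suc m + y"] binomial_symmetric[of "Suc m" "Suc m + y"] by simp_all
  then show ?thesis
    by (simp add: path_determinant_def algebra_simps)
qed

text \<open>
  The sum over the possible last rungs telescopes, first in \<open>b\<close> and then in \<open>a\<close>; the boundary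
  identity is what makes the inner sum start correctly at \<open>b = a\<close>.
\<close>

lemma sum_path_determinant:
  assumes "y \<le> x"
  shows "(\<Sum>a\<le>y. \<Sum>b\<in>{a..x}. path_determinant m a b) = path_determinant (Suc m) y x"
  using assms
proof (induction y)
  case 0
  have "(\<Sum>b\<le>x. path_determinant m 0 b) = path_determinant (Suc m) 0 x" for x
    by (induction x) (simp_all add: path_determinant_def binomial_eq_0)
  then show ?case
    by (simp add: atLeast0AtMost)
next
  case (Suc y)
  have "(\<Sum>b\<in>{Suc y..x}. path_determinant m (Suc y) b)
      = path_determinant (Suc m) (Suc y) x - path_determinant (Suc m) y x" if "y \<le> x" for x
    using that
  proof (induction rule: dec_induct)
    case base
    then show ?case by (simp add: path_determinant_boundary)
  next
    case (step x)
    then show ?case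
      using path_determinant_difference[of m y x] by simp
  qed
  with Suc show ?case by simp
qed

theorem card_ladder_fillings:
  assumes "y \<le> x"
  shows "finite (ladder_fillings m y x) \<and> int (card (ladder_fillings m y x)) = path_determinant m y x"
  using assms
proof (induction m arbitrary: y x)
  case 0
  then show ?case by (simp add: ladder_fillings_0 path_determinant_def)
next
  case (Suc m)
  let ?I = "SIGMA a : {..y}. {a..x}"
  have IH: "finite (ladder_fillings m (fst p) (snd p))"
    "int (card (ladder_fillings m (fst p) (snd p))) = path_determinant m (fst p) (snd p)"
    if "p \<in> ?I" for p
    using Suc.IH that by auto
  have bij: "bij_betw (\<lambda>((a, b), g). g(2 * m := a, 2 * m + 1 := b))
     (SIGMA p : ?I. ladder_fillings m (fst p) (snd p)) (ladder_fillings (Suc m) y x)"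
    using ladder_fillings_Suc[of m y x] by (simp add: case_prod_beta')
  have "finite (SIGMA p : ?I. ladder_fillings m (fst p) (snd p))"
    using IH by (intro finite_SigmaI) auto
  then have "finite (ladder_fillings (Suc m) y x)"
    using bij_betw_finite[OF bij] by simp
  moreover have "int (card (ladder_fillings (Suc m) y x))
      = int (\<Sum>p\<in>?I. card (ladder_fillings m (fst p) (snd p)))"
    unfolding bij_betw_same_card[OF bij, symmetric]
    by (subst card_SigmaI) (use IH in auto)
  moreover have "\<dots> = (\<Sum>p\<in>?I. path_determinant m (fst p) (snd p))"
    using IH by simp
  moreover have "\<dots> = (\<Sum>a\<le>y. \<Sum>b\<in>{a..x}. path_determinant m a b)"
    by (subst sum.Sigma) (auto simp: case_prod_beta')
  ultimately show ?case
    using sum_path_determinant[OF Suc.prems] by simp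
qed

section \<open>Lattice points of dilated order polytopes\<close>

text \<open>
  Order-reversing maps, which are the \<open>P\<close>-partitions in Stanley's sense. The relation \<open>r\<close> may be a
  strict order or any relation that generates it.
\<close>

definition P_partitions :: "'a set \<Rightarrow> ('a \<times> 'a) set \<Rightarrow> nat \<Rightarrow> ('a \<Rightarrow> nat) set" where
  "P_partitions P r t = {g \<in> P \<rightarrow>\<^sub>E {..t}. \<forall>(i, j)\<in>r. g j \<le> g i}"

text \<open>
  Lattice points are order-preserving, and \<open>v \<mapsto> t - v\<close> reverses the order. For \<open>t = 0\<close> the
  dilate is the origin, since the order polytope is nonempty; the witness below covers this case
  because \<open>0 / 0 = 0\<close> in HOL.
\<close>

lemma lattice_points_eq_P_partitions:
  assumes r: "r \<subseteq> P \<times> P"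
  shows "dilate P t (order_polytope P r) \<inter> (P \<rightarrow>\<^sub>E \<int>)
         = (\<lambda>g. \<lambda>i\<in>P. real (t - g i)) ` P_partitions P r t" (is "?L = ?f ` _")
proof (intro equalityI subsetI)
  fix x assume "x \<in> ?L"
  then obtain y where y: "y \<in> order_polytope P r" and x: "x = (\<lambda>i\<in>P. real t * y i)"
    and int: "x \<in> P \<rightarrow>\<^sub>E \<int>"
    by (auto simp: dilate_def)
  have bounds: "0 \<le> x i \<and> x i \<le> real t" if "i \<in> P" for i
    using y that by (auto simp: x order_polytope_def PiE_def Pi_def mult_left_le)
  have mono: "x i \<le> x j" if "(i, j) \<in> r" for i j
    using y that r by (auto simp: x order_polytope_def intro!: mult_left_mono)
  have nat: "real (nat \<lfloor>x i\<rfloor>) = x i" if "i \<in> P" for i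
  proof -
    have "x i \<in> \<int>"
      using int that by auto
    then show ?thesis
      using bounds[OF that] by (auto elim!: Ints_cases)
  qed
  have le: "nat \<lfloor>x i\<rfloor> \<le> t" if "i \<in> P" for i
    using nat[OF that] bounds[OF that] by linarith
  define g where "g = (\<lambda>i\<in>P. t - nat \<lfloor>x i\<rfloor>)"
  have "g \<in> P_partitions P r t"
    using mono r by (auto simp: P_partitions_def g_def intro!: diff_le_mono2 nat_mono floor_mono)
  moreover have "x = ?f g"
    using int nat le by (auto simp: g_def fun_eq_iff PiE_def extensional_def)
  ultimately show "x \<in> ?f ` P_partitions P r t"
    by blast
next
  fix x assume "x \<in> ?f ` P_partitions P r t"
  then obtain g where g: "g \<in> P_partitions P r t" and x: "x = ?f g"
    by blast
  define y where "y = (\<lambda>i\<in>P. real (t - g i) / real t)"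
  have "y \<in> order_polytope P r"
    using g r by (auto simp: order_polytope_def P_partitions_def y_def divide_le_eq
        intro!: divide_right_mono diff_le_mono2)
  moreover have "x = (\<lambda>i\<in>P. real t * y i)"
    by (auto simp: x y_def)
  moreover have "x \<in> P \<rightarrow>\<^sub>E \<int>"
    by (auto simp: x)
  ultimately show "x \<in> ?L"
    by (auto simp: dilate_def)
qed

lemma card_lattice_points:
  assumes "r \<subseteq> P \<times> P"
  shows "card (dilate P t (order_polytope P r) \<inter> (P \<rightarrow>\<^sub>E \<int>)) = card (P_partitions P r t)"
proof -
  have "inj_on (\<lambda>g. \<lambda>i\<in>P. real (t - g i)) (P_partitions P r t)"
  proof (rule inj_onI)
    fix g h
    assume g: "g \<in> P_partitions P r t" and h: "h \<in> P_partitions P r t"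
      and eq: "(\<lambda>i\<in>P. real (t - g i)) = (\<lambda>i\<in>P. real (t - h i))"
    show "g = h"
    proof
      fix i
      show "g i = h i"
      proof (cases "i \<in> P")
        case True
        then have "t - g i = t - h i"
          using fun_cong[OF eq, of i] by simp
        moreover have "g i \<le> t" "h i \<le> t"
          using g h True by (auto simp: P_partitions_def)
        ultimately show ?thesis by linarith
      next
        case False
        then show ?thesis
          using g h by (auto simp: P_partitions_def PiE_def extensional_def)
      qed
    qed
  qed
  then show ?thesis
    unfolding lattice_points_eq_P_partitions[OF assms] by (rule card_image)
qed

lemma P_partitions_trancl: "P_partitions P (r\<^sup>+) t = P_partitions P r t"
proof -
  have "g j \<le> g i" if "\<forall>(i, j)\<in>r. g j \<le> g i" "(i, j) \<in> r\<^sup>+" for g :: "'a \<Rightarrow> nat" and i j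
    using that(2) by induction (use that(1) in \<open>auto intro: order_trans\<close>)
  then show ?thesis
    unfolding P_partitions_def by (intro Collect_cong conj_cong refl) fast
qed

lemma card_P_partitions_image:
  assumes inj: "inj_on \<sigma> P" and r: "r \<subseteq> P \<times> P"
  shows "card (P_partitions (\<sigma> ` P) (map_prod \<sigma> \<sigma> ` r) t) = card (P_partitions P r t)"
proof (rule bij_betw_same_card, rule bij_betw_byWitness[where f' = "\<lambda>g. \<lambda>j\<in>\<sigma> ` P. g (inv_into P \<sigma> j)"])
  let ?A = "P_partitions (\<sigma> ` P) (map_prod \<sigma> \<sigma> ` r) t" and ?B = "P_partitions P r t"
  let ?f = "\<lambda>g. \<lambda>i\<in>P. g (\<sigma> i)" and ?f' = "\<lambda>g. \<lambda>j\<in>\<sigma> ` P. g (inv_into P \<sigma> j)"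
  show "\<forall>g\<in>?A. ?f' (?f g) = g"
    using inj by (auto simp: P_partitions_def fun_eq_iff PiE_def extensional_def)
  show "\<forall>g\<in>?B. ?f (?f' g) = g"
    using inj by (auto simp: P_partitions_def fun_eq_iff PiE_def extensional_def)
  show "?f ` ?A \<subseteq> ?B"
    using r by (fastforce simp: P_partitions_def)
  show "?f' ` ?B \<subseteq> ?A"
  proof (rule image_subsetI)
    fix g assume "g \<in> ?B"
    then have g: "g \<in> P \<rightarrow>\<^sub>E {..t}" "\<And>i j. (i, j) \<in> r \<Longrightarrow> g j \<le> g i"
      by (auto simp: P_partitions_def)
    have val: "?f' g (\<sigma> i) = g i" if "i \<in> P" for i
      using inj that by simp
    have "?f' g \<in> \<sigma> ` P \<rightarrow>\<^sub>E {..t}"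
    proof (rule PiE_I)
      fix j assume "j \<in> \<sigma> ` P"
      then show "?f' g j \<in> {..t}"
        using val g(1) by (auto simp del: restrict_apply)
    qed simp
    moreover have "?f' g (\<sigma> j) \<le> ?f' g (\<sigma> i)" if "(i, j) \<in> r" for i j
    proof -
      have "i \<in> P" "j \<in> P"
        using that r by auto
      then show ?thesis
        by (simp only: val g(2)[OF that])
    qed
    ultimately show "?f' g \<in> ?A"
      unfolding P_partitions_def by (auto simp del: restrict_apply)
  qed
qed

lemma fps_eq_divide_iff:
  fixes f g u :: "'a::field fps"
  assumes "u $ 0 \<noteq> 0"
  shows "f = g / u \<longleftrightarrow> u * f = g"
proof -
  have inv: "u * inverse u = 1"
    using inverse_mult_eq_1'[OF assms] .
  have "g / u = g * inverse u"
    by (rule fps_divide_unit[OF assms])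
  moreover have "u * (g * inverse u) = g"
    using inv by (simp add: mult.left_commute[of u])
  moreover have "u \<noteq> 0"
    using assms by auto
  ultimately show ?thesis
    by (metis mult_left_cancel)
qed

text \<open>
  Since \<open>1 - z\<close> is invertible as a power series, the definite description in the definition of the
  \<open>h\<^sup>*\<close>-polynomial denotes the only polynomial with the required property.
\<close>

lemma order_polytope_hstarI:
  assumes r: "r \<subseteq> P \<times> P"
    and h: "(1 - fps_X) ^ (card P + 1) * Abs_fps (\<lambda>t. real (card (P_partitions P r t))) = fps_of_poly h"
  shows "order_polytope_hstar P r = h"
proof -
  let ?E = "ehrhart_series P (order_polytope P r)"
  let ?U = "(1 - fps_X :: real fps) ^ (card P + 1)"
  have E: "?E = Abs_fps (\<lambda>t. real (card (P_partitions P r t)))"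
    by (simp add: ehrhart_series_def card_lattice_points[OF r])
  have U: "?U $ 0 \<noteq> 0"
    by (simp add: fps_nth_power_0)
  have "?E = fps_of_poly k / ?U \<longleftrightarrow> fps_of_poly k = fps_of_poly h" for k
    unfolding fps_eq_divide_iff[OF U] using h E by auto
  then show ?thesis
    unfolding order_polytope_hstar_def by (simp add: fps_of_poly_eq_iff)
qed

section \<open>Ladder posets\<close>

lemma snake_covers_Suc:
  "snake_covers w (Suc n) = snake_covers w n \<union>
     {(2 * n + 5, 2 * n + 3), (2 * n + 5, 2 * n + 4),
      (2 * n + 4, if (if n = 0 then letter_at w 1 = L else letter_at w n \<noteq> letter_at w (Suc n))
        then 2 * n + 1 else 2 * n + 2)}"
proof -
  have "2 * Suc n + 3 = 2 * n + 5" "2 * Suc n + 1 = 2 * n + 3" "2 * Suc n + 2 = 2 * n + 4"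
    "2 * Suc n - 1 = 2 * n + 1" "2 * Suc n = 2 * n + 2" "Suc n - 1 = n" "(Suc n = 1) = (n = 0)"
    by simp_all
  then show ?thesis
    by (simp only: snake_covers.simps Let_def)
qed

lemma snake_covers_subset:
  "snake_covers w n \<subseteq> {..<2 * n + 4} \<times> {..<2 * n + 4}"
proof (induction n)
  case (Suc n)
  then have "snake_covers w n \<subseteq> {..<2 * Suc n + 4} \<times> {..<2 * Suc n + 4}"
    by fastforce
  then show ?case
    unfolding snake_covers_Suc by simp
qed simp

text \<open>
  For the word of letters \<open>R\<close>, the three families of covers are the rungs and the two chains.
\<close>

lemma snake_covers_R:
  assumes "n \<le> N"
  shows "snake_covers (replicate N R) n
    = (\<lambda>i. (2 * i + 1, 2 * i)) ` {..<n + 2} \<union> (\<lambda>i. (2 * i + 2, 2 * i)) ` {..<n + 1}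
      \<union> (\<lambda>i. (2 * i + 3, 2 * i + 1)) ` {..<n + 1}"
  using assms
proof (induction n)
  case 0
  have "{..<0 + 2} = {0, 1 :: nat}" "{..<0 + 1} = {0 :: nat}"
    by auto
  then show ?case
    by (simp only: image_insert image_empty snake_covers.simps) (simp add: insert_commute eval_nat_numeral)
next
  case (Suc n)
  have "letter_at (replicate N R) n = R \<or> n = 0" "letter_at (replicate N R) (Suc n) = R"
    using Suc.prems by (auto simp: letter_at_def)
  then have covers: "snake_covers (replicate N R) (Suc n) = snake_covers (replicate N R) n \<union>
      {(2 * n + 5, 2 * n + 3), (2 * n + 5, 2 * n + 4), (2 * n + 4, 2 * n + 2)}"
    unfolding snake_covers_Suc by (cases "n = 0") simp_all
  have range: "{..<Suc n + k} = insert (n + k) {..<n + k}" for k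
    by auto
  have "A \<union> B \<union> C \<union> {(2 * n + 5, 2 * n + 3), (2 * n + 5, 2 * n + 4), (2 * n + 4, 2 * n + 2)}
      = insert (2 * (n + 2) + 1, 2 * (n + 2)) A \<union> insert (2 * (n + 1) + 2, 2 * (n + 1)) B
        \<union> insert (2 * (n + 1) + 3, 2 * (n + 1) + 1) C" for A B C :: "(nat \<times> nat) set"
  proof -
    have "2 * (n + 2) = 2 * n + 4" "2 * n + 4 + 1 = 2 * n + 5" "2 * (n + 1) = 2 * n + 2"
      "2 * n + 2 + 2 = 2 * n + 4" "2 * n + 2 + 3 = 2 * n + 5" "2 * n + 2 + 1 = 2 * n + 3"
      by simp_all
    then show ?thesis
      by (simp only:) blast
  qed
  then show ?case
    unfolding covers Suc.IH[OF Suc_leD[OF Suc.prems]] range image_insert .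
qed

text \<open>
  The two ladder words differ only in where \<open>4\<close> is attached: below \<open>1\<close> for \<open>L\<close>, below \<open>2\<close> for \<open>R\<close>.
  Both \<open>1\<close> and \<open>2\<close> lie between \<open>3\<close> and \<open>0\<close>, so exchanging them is an isomorphism.
\<close>

lemma snake_covers_L:
  assumes "n \<le> N"
  shows "snake_covers (replicate N L) n
    = map_prod (transpose 1 2) (transpose 1 2) ` snake_covers (replicate N R) n"
  using assms
proof (induction n)
  case 0
  show ?case by (simp add: transpose_def insert_commute)
next
  case (Suc n)
  have letter: "letter_at (replicate N l) n = l \<or> n = 0" "letter_at (replicate N l) (Suc n) = l" for l
    using Suc.prems by (auto simp: letter_at_def)
  have R: "snake_covers (replicate N R) (Suc n) = snake_covers (replicate N R) n \<union>
      {(2 * n + 5, 2 * n + 3), (2 * n + 5, 2 * n + 4), (2 * n + 4, 2 * n + 2)}"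
    using letter[of R] unfolding snake_covers_Suc by (cases "n = 0") simp_all
  have L: "snake_covers (replicate N L) (Suc n) = snake_covers (replicate N L) n \<union>
      {(2 * n + 5, 2 * n + 3), (2 * n + 5, 2 * n + 4), (2 * n + 4, if n = 0 then 1 else 2 * n + 2)}"
    using letter[of L] unfolding snake_covers_Suc by (cases "n = 0") simp_all
  have "transpose 1 2 (2 * n + 2) = (if n = 0 then 1 else 2 * n + 2)"
    "transpose 1 2 (2 * n + 3) = 2 * n + 3" "transpose 1 2 (2 * n + 4) = 2 * n + 4"
    "transpose 1 2 (2 * n + 5) = 2 * n + 5"
    by (simp_all add: transpose_def)
  then show ?case
    unfolding R L image_Un Suc.IH[OF Suc_leD[OF Suc.prems]]
    by (simp only: image_insert image_empty map_prod_simp)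
qed

lemma P_partitions_ladder:
  "P_partitions {..<2 * n + 4} (snake_covers (replicate n R) n) t = ladder_fillings (n + 2) t t"
proof -
  have split: "(\<forall>k<2 * m. Q k) \<longleftrightarrow> (\<forall>i<m. Q (2 * i) \<and> Q (2 * i + 1))" for Q :: "nat \<Rightarrow> bool" and m
  proof (intro iffI allI impI)
    fix k
    assume Q: "\<forall>i<m. Q (2 * i) \<and> Q (2 * i + 1)" and k: "k < 2 * m"
    show "Q k"
    proof (cases "even k")
      case True
      then show ?thesis using Q k by (auto elim!: evenE)
    next
      case False
      then show ?thesis using Q k by (auto elim!: oddE)
    qed
  qed auto
  have "g \<in> {..<2 * n + 4} \<rightarrow>\<^sub>E {..t} \<longleftrightarrow>
      g \<in> {..<2 * n + 4} \<rightarrow>\<^sub>E UNIV \<and> (\<forall>i<n + 2. g (2 * i) \<le> t \<and> g (2 * i + 1) \<le> t)" for g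
    using split[of "n + 2" "\<lambda>k. g k \<le> t"] by (auto simp: PiE_def Pi_def)
  moreover have twice: "2 * (n + 2) = 2 * n + 4"
    by simp
  ultimately show ?thesis
    unfolding P_partitions_def ladder_fillings_def snake_covers_R[OF order_refl] ball_Un twice
    by auto
qed

lemma card_P_partitions_ladder:
  assumes "w = replicate n L \<or> w = replicate n R"
  shows "real (card (P_partitions (snake_carrier w) (snake_less w) t))
       = real_of_int (path_determinant (n + 2) t t)"
proof -
  let ?P = "{..<2 * n + 4}"
  have len: "length w = n"
    using assms by auto
  have "transpose 1 2 ` ?P = ?P"
    by (rule transpose_image_eq) simp
  moreover have "inj_on (transpose 1 2) ?P"
    by (rule inj_on_subset[OF inj_transpose]) simp
  ultimately have "card (P_partitions ?P (snake_covers (replicate n L) n) t)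
      = card (P_partitions ?P (snake_covers (replicate n R) n) t)"
    using card_P_partitions_image[OF _ snake_covers_subset, of "transpose 1 2" n "replicate n R" t]
    unfolding snake_covers_L[OF order_refl] by simp
  then have "card (P_partitions (snake_carrier w) (snake_less w) t)
      = card (P_partitions ?P (snake_covers (replicate n R) n) t)"
    using assms len by (auto simp: snake_less_def snake_carrier_def P_partitions_trancl)
  then show ?thesis
    using card_ladder_fillings[of t t "n + 2"] by (simp add: P_partitions_ladder)
qed

theorem theorem4p9:
  fixes n :: nat and w :: snake_word
  assumes ladder: "w = replicate n L \<or> w = replicate n R"
  shows "snake_hstar w = (\<Sum>i=0..n+1. monom (narayana (n + 2) (i + 1)) i)"
  unfolding snake_hstar_def
proof (rule order_polytope_hstarI)
  have len: "length w = n"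
    using ladder by auto
  show "snake_less w \<subseteq> snake_carrier w \<times> snake_carrier w"
    unfolding snake_less_def snake_carrier_def by (intro trancl_subset_Sigma snake_covers_subset)
  have "{0..n + 1} = {..<n + 2}"
    by auto
  moreover have "card (snake_carrier w) + 1 = 2 * (n + 2) + 1"
    by (simp add: snake_carrier_def len)
  ultimately show "(1 - fps_X) ^ (card (snake_carrier w) + 1)
      * Abs_fps (\<lambda>t. real (card (P_partitions (snake_carrier w) (snake_less w) t)))
      = fps_of_poly (\<Sum>i=0..n+1. monom (narayana (n + 2) (i + 1)) i)"
    using path_determinant_series[of "n + 2"] by (simp only: card_P_partitions_ladder[OF ladder])
qed

end
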